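(* Let $(L_m)_{m\ge1}$ and $(Z_m)_{m\ge1}$ be two sequences of positive linear operators such that $$\lim_{n\to\infty}L_m\left(f\left(\frac{t}{n}\right);nx\right)=Z_m(f(t);x)$$ for all $m\ge1$, $x\ge0$, $f\in C_b[0,\infty)$. Then $$Z_m\left(f\left(\frac{t}{\nu}\right);\nu x\right)=Z_m(f(t);x)$$ for all $m\ge1$, $\nu\in\mathbb{N}$, $x\ge0$ and $f\in C_b[0,\infty)$.
   Context: $C_b[0,\infty)$ is the space of real-valued continuous bounded functions on $[0,\infty)$; the operators $L_m$ and $Z_m$ map $C_b[0,\infty)$ to real functions on $[0,\infty)$. The notation $L_m(f(t/n);nx)$ means $L_m$ applied to the function $t\mapsto f(t/n)$, evaluated at $nx$; similarly for $Z_m(f(t/\nu);\nu x)$. *)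

theory Defs
  imports "HOL-Analysis.Analysis"
begin

(* A function on [0,\<infinity>) is represented by the unique HOL function that is
   "undefined" off {0..}; hence operators on Cb depend only on values on [0,\<infinity>). *)
definition Cb :: "(real \<Rightarrow> real) set" where
  "Cb = {f \<in> extensional {0..}. continuous_on {0..} f \<and> bounded (f ` {0..})}"

(* T f is a function on [0,\<infinity>): only its values at x \<ge> 0 carry meaning. *)
definition positive_linear_operator :: "((real \<Rightarrow> real) \<Rightarrow> real \<Rightarrow> real) \<Rightarrow> bool" where
  "positive_linear_operator T \<longleftrightarrow>
     (\<forall>f\<in>Cb. \<forall>g\<in>Cb. \<forall>a b. \<forall>x\<ge>0.
        T (\<lambda>t\<in>{0..}. a * f t + b * g t) x = a * T f x + b * T g x) \<and>
     (\<forall>f\<in>Cb. (\<forall>t\<ge>0. f t \<ge> 0) \<longrightarrow> (\<forall>x\<ge>0. T f x \<ge> 0))"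

end

theory Submission
  imports Defs
begin

text \<open>
  Dilating twice is the same as dilating once: for \<open>g(t) = f(t/\<nu>)\<close> one has
  \<open>g(t/n) = f(t/(n\<nu>))\<close> and \<open>n(\<nu>x) = (n\<nu>)x\<close>. Hence the sequence whose limit defines
  \<open>Z\<^sub>m(g; \<nu>x)\<close> is the subsequence along the multiples of \<open>\<nu>\<close> of the one whose limit defines
  \<open>Z\<^sub>m(f; x)\<close>, and uniqueness of limits gives the claim. The hypothesis applies
  to \<open>g\<close> because a dilation of a bounded continuous function is again bounded and continuous.
\<close>

lemma Cb_dilation:
  assumes "f \<in> Cb" and "c \<ge> 0"
  shows "(\<lambda>t\<in>{0..}. f (t / c)) \<in> Cb"
proof -
  have maps: "(\<lambda>t. t / c) ` {0..} \<subseteq> {0..}"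
    using assms(2) by auto
  have f: "continuous_on {0..} f" "bounded (f ` {0..})"
    using assms(1) by (auto simp: Cb_def)
  \<comment> \<open>Division by a constant is multiplication by its inverse, hence continuous even for \<open>c = 0\<close>.\<close>
  have "continuous_on {0..} (\<lambda>t. t / c)"
    unfolding divide_inverse by (intro continuous_intros)
  then have "continuous_on {0..} (\<lambda>t. f (t / c))"
    using continuous_on_compose2[OF f(1)] maps by blast
  then have "continuous_on {0..} (\<lambda>t\<in>{0..}. f (t / c))"
    by (rule continuous_on_eq) simp
  moreover have "bounded ((\<lambda>t. f (t / c)) ` {0..})"
    by (rule bounded_subset[OF f(2)]) (use maps in auto)
  ultimately show ?thesis
    by (simp add: Cb_def)
qed

lemma dilation_dilation:
  fixes f :: "real \<Rightarrow> real"
  assumes "b \<ge> 0"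
  shows "(\<lambda>t\<in>{0..}. (\<lambda>s\<in>{0..}. f (s / a)) (t / b)) = (\<lambda>t\<in>{0..}. f (t / (b * a)))"
  using assms by (auto simp: fun_eq_iff)

theorem proposition12p2:
  fixes L Z :: "nat \<Rightarrow> (real \<Rightarrow> real) \<Rightarrow> real \<Rightarrow> real"
  assumes "\<And>m. m \<ge> 1 \<Longrightarrow> positive_linear_operator (L m)"
    and "\<And>m. m \<ge> 1 \<Longrightarrow> positive_linear_operator (Z m)"
    and "\<And>m x f. m \<ge> 1 \<Longrightarrow> x \<ge> 0 \<Longrightarrow> f \<in> Cb \<Longrightarrow>
      (\<lambda>n. L m (\<lambda>t\<in>{0..}. f (t / real n)) (real n * x)) \<longlonglongrightarrow> Z m f x"
  shows "\<forall>m\<ge>1. \<forall>\<nu>::nat. \<nu> \<ge> 1 \<longrightarrow> (\<forall>x\<ge>0. \<forall>f\<in>Cb.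
      Z m (\<lambda>t\<in>{0..}. f (t / real \<nu>)) (real \<nu> * x) = Z m f x)"
proof (intro allI impI ballI)
  fix m \<nu> :: nat and x :: real and f
  assume m: "m \<ge> 1" and \<nu>: "\<nu> \<ge> 1" and x: "x \<ge> 0" and f: "f \<in> Cb"
  define g where "g = (\<lambda>t\<in>{0..}. f (t / real \<nu>))"
  define S where "S = (\<lambda>n. L m (\<lambda>t\<in>{0..}. f (t / real n)) (real n * x))"
  have "g \<in> Cb"
    unfolding g_def by (intro Cb_dilation f) simp
  then have "(\<lambda>n. L m (\<lambda>t\<in>{0..}. g (t / real n)) (real n * (real \<nu> * x)))
      \<longlonglongrightarrow> Z m g (real \<nu> * x)"
    using assms(3) m x by simp
  moreover have "(\<lambda>n. L m (\<lambda>t\<in>{0..}. g (t / real n)) (real n * (real \<nu> * x))) = (\<lambda>n. S (n * \<nu>))"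
    unfolding g_def S_def by (simp only: dilation_dilation of_nat_0_le_iff of_nat_mult mult.assoc)
  ultimately have "(\<lambda>n. S (n * \<nu>)) \<longlonglongrightarrow> Z m g (real \<nu> * x)"
    by simp
  moreover have "(\<lambda>n. S (n * \<nu>)) \<longlonglongrightarrow> Z m f x"
  proof -
    have "S \<longlonglongrightarrow> Z m f x"
      unfolding S_def using assms(3) m x f by simp
    moreover have "strict_mono (\<lambda>n. n * \<nu>)"
      using \<nu> by (simp add: strict_mono_def)
    ultimately show ?thesis
      using LIMSEQ_subseq_LIMSEQ by (fastforce simp: o_def)
  qed
  ultimately show "Z m (\<lambda>t\<in>{0..}. f (t / real \<nu>)) (real \<nu> * x) = Z m f x"
    unfolding g_def by (rule LIMSEQ_unique)
qed

end
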